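(* Let $B_2$ be the unit ball of $\mathbb C^2$ with Bergman kernel $K_{B_2}$, let $G=\{r,\mathrm{id}\}$ with $r(z_1,z_2)=(-z_1,z_2)$ (the covering group of the normal ramified covering $\pi(z_1,z_2)=(z_1^2,z_2)$ of $\pi(B_2)$), and for $p\in(1,\infty)$ let $$K_{G,p}(z,w)=|z_1|^{\frac2p-1}K_G(z,w)|w_1|^{1-\frac2p},\qquad K_G(z,w)=\tfrac12\big(K_{B_2}(z,w)-K_{B_2}(z,r.w)\big).$$ Then for every $p\in(1,\infty)$ the integral operator $f\mapsto\int_{B_2}|K_{G,p}(\cdot,w)|f(w)\,dw$ is bounded on $L^p(B_2)$.
   Context: $K_{B_2}(z,w)=c\,(1-z_1\overline w_1-z_2\overline w_2)^{-3}$ for a positive constant $c$ is the Bergman kernel of $B_2$ (integral kernel of the orthogonal projection of $L^2(B_2)$ onto holomorphic square-integrable functions). Here $|z_1|=|J_G(z)|$ is the modulus of the Jacobian polynomial of $G$, and $\det r=-1$. *)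

theory Defs
  imports "HOL-Analysis.Analysis"
begin

text \<open>Points of C^2 are pairs of complex numbers; Lebesgue measure on C^2 = R^4
  is the measure lebesgue on the euclidean space complex \<times> complex.\<close>

definition ball2 :: "(complex \<times> complex) set" where
  "ball2 = {z. (cmod (fst z))^2 + (cmod (snd z))^2 < 1}"

definition bergman_B2 :: "complex \<times> complex \<Rightarrow> complex \<times> complex \<Rightarrow> complex" where
  "bergman_B2 z w =
     complex_of_real (2 / pi^2) / (1 - fst z * cnj (fst w) - snd z * cnj (snd w)) ^ 3"

definition refl_r :: "complex \<times> complex \<Rightarrow> complex \<times> complex" where
  "refl_r z = (- fst z, snd z)"

definition K_G :: "complex \<times> complex \<Rightarrow> complex \<times> complex \<Rightarrow> complex" where
  "K_G z w = (bergman_B2 z w - bergman_B2 z (refl_r w)) / 2"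

definition K_Gp :: "real \<Rightarrow> complex \<times> complex \<Rightarrow> complex \<times> complex \<Rightarrow> complex" where
  "K_Gp p z w = complex_of_real (cmod (fst z) powr (2 / p - 1)) * K_G z w
                * complex_of_real (cmod (fst w) powr (1 - 2 / p))"

end

theory Submission
  imports Defs
begin

text \<open>
  Put \<open>A = 1 - z\<^sub>2 w\<^sub>2*\<close> and \<open>B = z\<^sub>1 w\<^sub>1*\<close> (star denoting conjugation). Then
  \<open>K\<^sub>G = c B (3 A\<^sup>2 + B\<^sup>2) / (A\<^sup>2 - B\<^sup>2)\<^sup>3\<close>, so the weights turn the factor \<open>B\<close> into
  \<open>|z\<^sub>1|\<close> to the power \<open>2/p\<close> times \<open>|w\<^sub>1|\<close> to the power \<open>2 - 2/p\<close>, which by Young's inequality is at most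
  \<open>|z\<^sub>1|\<^sup>2 + |w\<^sub>1|\<^sup>2 \<le> 2 |A|\<close>. As \<open>|A|\<close> and \<open>|B|\<close> are at most the larger of \<open>|A - B|\<close> and \<open>|A + B|\<close>,
  the twisted kernel is dominated, for every \<open>p\<close>, by a multiple of \<open>|K(z,w)| + |K(z,rw)|\<close>,
  where \<open>K\<close> is the Bergman kernel of the ball.
  The positive Bergman operator is bounded by the Schur test with the weight
  \<open>1 - |z|\<^sup>2\<close> to the power \<open>- 1/(pq)\<close>, \<open>q\<close> being the conjugate exponent. The Forelli--Rudin estimate it needs
  follows by rotating \<open>z\<close> to the first axis, integrating out the second variable, and
  comparing \<open>|1 - r u|\<close> with \<open>max (1 - r) (|1 - u| / 2)\<close>.
\<close>

subsection \<open>Orthogonal invariance of Lebesgue measure\<close>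

lemma nn_integral_lborel_translate:
  fixes c :: "'a::euclidean_space"
  assumes [measurable]: "f \<in> borel_measurable borel"
  shows "(\<integral>\<^sup>+x. f (c + x) \<partial>lborel) = (\<integral>\<^sup>+x. f x \<partial>lborel)"
proof -
  have "(\<integral>\<^sup>+x. f x \<partial>lborel) = (\<integral>\<^sup>+x. f x \<partial>distr lborel borel ((+) c))"
    by (simp add: lborel_distr_plus)
  then show ?thesis
    by (simp add: nn_integral_distr)
qed

text \<open>Uniqueness of Haar measure: integrate \<open>f (U x + y)\<close> over the unit ball in \<open>y\<close> and swap the
  order of integration; the ball is invariant under \<open>U\<close>, which fixes the constant.\<close>

lemma nn_integral_lborel_orthogonal_transformation:
  fixes U :: "'a::euclidean_space \<Rightarrow> 'a"
  assumes U: "orthogonal_transformation U" and f [measurable]: "f \<in> borel_measurable borel"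
  shows "(\<integral>\<^sup>+x. f (U x) \<partial>lborel) = (\<integral>\<^sup>+x. f x \<partial>lborel)"
proof -
  have lin: "linear U"
    using U by (rule orthogonal_transformation_linear)
  have [measurable]: "U \<in> borel_measurable borel"
    using lin by (intro borel_measurable_continuous_onI linear_continuous_on linear_conv_bounded_linear[THEN iffD1])
  obtain V where V: "\<And>y. U (V y) = y"
    using orthogonal_transformation_surj[OF U] by (metis surjD)
  define g :: "'a \<Rightarrow> ennreal" where "g = indicator (ball 0 1)"
  have [measurable]: "g \<in> borel_measurable borel"
    unfolding g_def by (intro borel_measurable_indicator borel_open) auto
  define c where "c = emeasure lborel (ball (0::'a) 1)"
  \<comment> \<open>Both properties are needed at the very end, where the factor \<open>c\<close> is
    cancelled in \<open>ennreal\<close>.\<close>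
  have c: "c \<noteq> 0" "c \<noteq> \<infinity>"
    unfolding c_def using unit_ball_vol_pos[of "real DIM('a)"] by (auto simp: emeasure_ball simp del: unit_ball_vol_pos)
  \<comment> \<open>Since \<open>y = U (V y)\<close> and \<open>U\<close> is isometric,
    \<open>U x\<close> lies in the unit ball about \<open>y\<close> exactly when \<open>x\<close>
    lies in the unit ball about \<open>V y\<close>, and all unit balls have the same volume.\<close>
  have ball: "(\<integral>\<^sup>+x. g (y - U x) \<partial>lborel) = c" for y
  proof -
    have "norm (U x - y) = norm (V y - x)" for x
      using orthogonal_transformation_norm[OF U, of "V y - x"] V linear_diff[OF lin]
      by (simp add: norm_minus_commute)
    then have "g (y - U x) = indicator (ball (V y) 1) x" for x
      by (simp add: g_def indicator_def dist_norm)
    then show ?thesis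
      by (simp add: c_def emeasure_ball)
  qed
  have "(\<integral>\<^sup>+x. f (U x) \<partial>lborel) * c
      = (\<integral>\<^sup>+y. (\<integral>\<^sup>+x. f (U x) \<partial>lborel) * g y \<partial>lborel)"
    unfolding c_def g_def by (subst nn_integral_cmult_indicator) auto
  also have "\<dots> = (\<integral>\<^sup>+y. (\<integral>\<^sup>+x. f (U x + y) * g y \<partial>lborel) \<partial>lborel)"
  proof (rule nn_integral_cong)
    fix y :: 'a
    \<comment> \<open>Translating \<open>x\<close> by \<open>V y\<close> translates
      \<open>U x\<close> by \<open>y\<close>, by linearity.\<close>
    have "(\<integral>\<^sup>+x. f (U x) \<partial>lborel) = (\<integral>\<^sup>+x. f (U x + y) \<partial>lborel)"
      using nn_integral_lborel_translate[of "\<lambda>x. f (U x)" "V y"]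
      by (simp add: linear_add[OF lin] V add.commute)
    then show "(\<integral>\<^sup>+x. f (U x) \<partial>lborel) * g y
        = (\<integral>\<^sup>+x. f (U x + y) * g y \<partial>lborel)"
      by (simp add: nn_integral_multc)
  qed
  also have "\<dots> = (\<integral>\<^sup>+x. (\<integral>\<^sup>+y. f (U x + y) * g y \<partial>lborel) \<partial>lborel)"
    by (rule lborel_pair.Fubini') measurable
  also have "\<dots> = (\<integral>\<^sup>+x. (\<integral>\<^sup>+y. f y * g (y - U x) \<partial>lborel) \<partial>lborel)"
  proof (rule nn_integral_cong)
    fix x :: 'a
    show "(\<integral>\<^sup>+y. f (U x + y) * g y \<partial>lborel)
        = (\<integral>\<^sup>+y. f y * g (y - U x) \<partial>lborel)"
      using nn_integral_lborel_translate[of "\<lambda>y. f y * g (y - U x)" "U x"]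
      by simp
  qed
  also have "\<dots> = (\<integral>\<^sup>+y. (\<integral>\<^sup>+x. f y * g (y - U x) \<partial>lborel) \<partial>lborel)"
    by (rule lborel_pair.Fubini'[symmetric]) measurable
  also have "\<dots> = (\<integral>\<^sup>+y. f y * c \<partial>lborel)"
    by (simp add: nn_integral_cmult ball)
  also have "\<dots> = (\<integral>\<^sup>+y. f y \<partial>lborel) * c"
    by (simp add: nn_integral_multc)
  finally show ?thesis
    using c by (simp add: mult.commute[of _ c] ennreal_mult_cancel_left)
qed

subsection \<open>Integrals of powers over discs\<close>

lemma nn_integral_powr_atLeast:
  fixes c e :: real
  assumes "0 < c" "e < -1"
  shows "(\<integral>\<^sup>+x. ennreal (x powr e) * indicator {c..} x \<partial>lborel) = ennreal (c powr (e + 1) / - (e + 1))"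
proof -
  define F where "F = (\<lambda>x::real. x powr (e + 1) / (e + 1))"
  have "((\<lambda>x::real. x powr (e + 1)) \<longlongrightarrow> 0) at_top"
    using assms by (intro tendsto_neg_powr filterlim_ident) auto
  then have lim: "(F \<longlongrightarrow> 0) at_top"
    unfolding F_def using tendsto_divide[OF _ tendsto_const, of _ 0 at_top "e + 1"] assms by fastforce
  have "(\<integral>\<^sup>+x. ennreal (x powr e) * indicator {c..} x \<partial>lborel) = ennreal (0 - F c)"
  proof (rule nn_integral_FTC_atLeast[OF _ _ _ lim])
    fix x assume "c \<le> x"
    with assms show "DERIV F x :> x powr e"
      unfolding F_def by (auto intro!: derivative_eq_intros)
  qed auto
  also have "0 - F c = c powr (e + 1) / - (e + 1)"
    by (simp add: F_def divide_minus_right del: minus_add_distrib)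
  finally show ?thesis .
qed

lemma nn_integral_powr_Icc:
  fixes b c t :: real
  assumes "0 < b" "b \<le> c" "0 < t"
  shows "(\<integral>\<^sup>+y. ennreal (t * y powr (t - 1)) * indicator {b..c} y \<partial>lborel) = ennreal (c powr t - b powr t)"
proof (rule nn_integral_FTC_Icc)
  show "DERIV (\<lambda>y. y powr t) x :> t * x powr (t - 1)" if "x \<in> {b..c}" for x
    using that assms by (auto intro!: derivative_eq_intros)
qed (use assms in auto)

text \<open>The annulus lies between the circles of squared radii \<open>s\<close> and
  \<open>\<rho>\<close>, and its area is linear in the squared radii. Hence the bound depends only
  on the width \<open>\<eta>\<close>, not on \<open>\<rho>\<close>. Truncating at 0 in
  \<open>s\<close> covers the case where the annulus fills the whole disc.\<close>

lemma emeasure_lborel_annulus_le: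
  fixes \<rho> \<eta> :: real
  assumes "0 < \<eta>"
  shows "emeasure lborel {u::complex. (cmod u)\<^sup>2 < \<rho> \<and> \<rho> - (cmod u)\<^sup>2 \<le> \<eta>} \<le> ennreal (pi * \<eta>)"
proof -
  define s where "s = max 0 (\<rho> - \<eta>)"
  have "{u::complex. (cmod u)\<^sup>2 < \<rho> \<and> \<rho> - (cmod u)\<^sup>2 \<le> \<eta>} = {}" if "\<rho> \<le> 0"
    using that by (auto simp: not_less intro: order_trans[OF _ zero_le_power2])
  moreover have "emeasure lborel {u::complex. (cmod u)\<^sup>2 < \<rho> \<and> \<rho> - (cmod u)\<^sup>2 \<le> \<eta>} \<le> ennreal (pi * \<eta>)"
    if "0 < \<rho>"
  proof -
    have s: "0 \<le> s" "s \<le> \<rho>"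
      using assms that by (auto simp: s_def)
    have "{u::complex. (cmod u)\<^sup>2 < \<rho> \<and> \<rho> - (cmod u)\<^sup>2 \<le> \<eta>} \<subseteq> ball 0 (sqrt \<rho>) - ball 0 (sqrt s)"
    proof
      fix u :: complex
      assume "u \<in> {u. (cmod u)\<^sup>2 < \<rho> \<and> \<rho> - (cmod u)\<^sup>2 \<le> \<eta>}"
      then have u: "(cmod u)\<^sup>2 < \<rho>" "s \<le> (cmod u)\<^sup>2"
        by (auto simp: s_def)
      then have "cmod u < sqrt \<rho>"
        by (simp add: real_less_rsqrt)
      moreover have "sqrt s \<le> cmod u"
        using u(2) by (simp add: real_le_lsqrt)
      ultimately show "u \<in> ball 0 (sqrt \<rho>) - ball 0 (sqrt s)"
        by simp
    qed
    then have "emeasure lborel {u::complex. (cmod u)\<^sup>2 < \<rho> \<and> \<rho> - (cmod u)\<^sup>2 \<le> \<eta>}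
        \<le> emeasure lborel (ball (0::complex) (sqrt \<rho>) - ball 0 (sqrt s))"
      by (intro emeasure_mono) auto
    also have "\<dots> = emeasure lborel (ball (0::complex) (sqrt \<rho>)) - emeasure lborel (ball (0::complex) (sqrt s))"
      using s by (intro emeasure_Diff) (auto simp: emeasure_ball intro: less_le_trans[OF _ real_sqrt_le_mono])
    also have "\<dots> = ennreal (pi * \<rho> - pi * s)"
      using s by (simp add: emeasure_ball unit_ball_vol_2 flip: ennreal_minus)
    also have "\<dots> \<le> ennreal (pi * \<eta>)"
    proof (rule ennreal_leI)
      have "\<rho> - s \<le> \<eta>"
        by (simp add: s_def)
      then show "pi * \<rho> - pi * s \<le> pi * \<eta>"
        by (simp add: mult_left_mono flip: right_diff_distrib)
    qed
    finally show ?thesis .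
  qed
  ultimately show ?thesis
    by (metis emeasure_empty not_le zero_le)
qed

text \<open>Layer-cake argument in the reciprocal of the boundary defect
  \<open>\<rho> - |u|^2\<close>: the set where the defect is at most \<open>1/y\<close> has area at
  most \<open>pi/y\<close>, and \<open>y powr (t - 2)\<close> is integrable at infinity because
  \<open>t < 1\<close>.\<close>

lemma nn_integral_disc_boundary_powr_le:
  fixes \<rho> t :: real
  assumes t: "0 < t" "t < 1" and \<rho>: "0 < \<rho>"
  shows "(\<integral>\<^sup>+u. ennreal ((\<rho> - (cmod u)\<^sup>2) powr -t) * indicator {u. (cmod u)\<^sup>2 < \<rho>} u \<partial>lborel)
           \<le> ennreal (pi / (1 - t) * \<rho> powr (1 - t))"
proof -
  define D where "D = {u::complex. (cmod u)\<^sup>2 < \<rho>}"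
  define S where "S y = {u::complex. (cmod u)\<^sup>2 < \<rho> \<and> \<rho> - (cmod u)\<^sup>2 \<le> 1 / y}" for y :: real
  have [measurable]: "D \<in> sets borel" "\<And>y. S y \<in> sets borel"
    unfolding D_def S_def by measurable
  \<comment> \<open>With \<open>m\<close> the defect at \<open>u\<close>, this is
    \<open>m powr -t\<close> written as its least value \<open>\<rho> powr -t\<close> plus the
    integral of the derivative of \<open>y powr t\<close> from \<open>1/\<rho>\<close> to
    \<open>1/m\<close>. For such \<open>y\<close>, membership \<open>u \<in> S y\<close> encodes the
    upper limit \<open>y \<le> 1/m\<close>.\<close>
  have split: "ennreal ((\<rho> - (cmod u)\<^sup>2) powr -t) * indicator D u
      = ennreal (\<rho> powr -t) * indicator D u
        + (\<integral>\<^sup>+y. ennreal (t * y powr (t - 1)) * indicator {1/\<rho>..} y * indicator (S y) u \<partial>lborel)"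
    for u
  proof (cases "u \<in> D")
    case True
    define m where "m = \<rho> - (cmod u)\<^sup>2"
    have m: "0 < m" "m \<le> \<rho>"
      using True by (auto simp: m_def D_def)
    have "(\<integral>\<^sup>+y. ennreal (t * y powr (t - 1)) * indicator {1/\<rho>..} y * indicator (S y) u \<partial>lborel)
        = (\<integral>\<^sup>+y. ennreal (t * y powr (t - 1)) * indicator {1/\<rho>..1/m} y \<partial>lborel)"
    proof (intro nn_integral_cong)
      fix y :: real
      have "u \<in> S y \<longleftrightarrow> y \<le> 1 / m" if "1 / \<rho> \<le> y"
      proof -
        have "0 < y"
          using that \<rho> by (meson less_le_trans zero_less_divide_1_iff)
        then show ?thesis
          using m True by (simp add: S_def D_def m_def[symmetric] pos_le_divide_eq mult.commute)
      qed
      then show "ennreal (t * y powr (t - 1)) * indicator {1/\<rho>..} y * indicator (S y) u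
          = ennreal (t * y powr (t - 1)) * indicator {1/\<rho>..1/m} y"
        by (auto simp: indicator_def)
    qed
    also have "\<dots> = ennreal ((1/m) powr t - (1/\<rho>) powr t)"
      using m \<rho> t by (intro nn_integral_powr_Icc) (auto simp: frac_le)
    also have "\<dots> = ennreal (m powr -t - \<rho> powr -t)"
      using m \<rho> by (simp add: powr_minus_divide powr_divide)
    finally show ?thesis
      using True m t by (simp add: m_def[symmetric] powr_mono2' flip: ennreal_plus)
  next
    case False
    then have "u \<notin> S y" for y
      by (auto simp: S_def D_def)
    with False show ?thesis
      by simp
  qed
  have [measurable]: "Measurable.pred (borel \<Otimes>\<^sub>M borel) (\<lambda>x. fst x \<in> S (snd x))"
    "Measurable.pred (borel \<Otimes>\<^sub>M borel) (\<lambda>x. snd x \<in> S (fst x))"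
    unfolding S_def by measurable
  have "D \<subseteq> S (1 / \<rho>)"
    using \<rho> by (auto simp: S_def D_def)
  then have D: "emeasure lborel D \<le> ennreal (pi * \<rho>)"
    using emeasure_mono[of D "S (1/\<rho>)" lborel] emeasure_lborel_annulus_le[OF \<rho>, of \<rho>]
    by (force simp: S_def)
  have "(\<integral>\<^sup>+u. ennreal ((\<rho> - (cmod u)\<^sup>2) powr -t) * indicator D u \<partial>lborel)
      = (\<integral>\<^sup>+u. ennreal (\<rho> powr -t) * indicator D u \<partial>lborel)
        + (\<integral>\<^sup>+u. (\<integral>\<^sup>+y. ennreal (t * y powr (t - 1)) * indicator {1/\<rho>..} y * indicator (S y) u \<partial>lborel) \<partial>lborel)"
    unfolding split by (subst nn_integral_add) (auto simp: indicator_def[of "S _"])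
  also have "(\<integral>\<^sup>+u. (\<integral>\<^sup>+y. ennreal (t * y powr (t - 1)) * indicator {1/\<rho>..} y * indicator (S y) u \<partial>lborel) \<partial>lborel)
      = (\<integral>\<^sup>+y. (\<integral>\<^sup>+u. ennreal (t * y powr (t - 1)) * indicator {1/\<rho>..} y * indicator (S y) u \<partial>lborel) \<partial>lborel)"
    by (rule lborel_pair.Fubini') (simp add: split_beta' indicator_def[of "S _"])
  also have "\<dots> = (\<integral>\<^sup>+y. ennreal (t * y powr (t - 1)) * indicator {1/\<rho>..} y * emeasure lborel (S y) \<partial>lborel)"
    by (intro nn_integral_cong nn_integral_cmult_indicator) simp
  also have "\<dots> \<le> (\<integral>\<^sup>+y. ennreal (t * pi) * (ennreal (y powr (t - 2)) * indicator {1/\<rho>..} y) \<partial>lborel)"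
  proof (intro nn_integral_mono)
    fix y :: real
    show "ennreal (t * y powr (t - 1)) * indicator {1/\<rho>..} y * emeasure lborel (S y)
        \<le> ennreal (t * pi) * (ennreal (y powr (t - 2)) * indicator {1/\<rho>..} y)"
    proof (cases "1/\<rho> \<le> y")
      case True
      then have y: "0 < y"
        using \<rho> by (meson less_le_trans zero_less_divide_1_iff)
      have "ennreal (t * y powr (t - 1)) * emeasure lborel (S y) \<le> ennreal (t * y powr (t - 1)) * ennreal (pi * (1 / y))"
        unfolding S_def using y by (intro mult_left_mono emeasure_lborel_annulus_le) auto
      also have "\<dots> = ennreal (t * pi * y powr (t - 2))"
      proof -
        have "y powr (t - 1) = y powr (t - 2) * y"
          using y powr_add[of y "t - 2" 1] by simp
        then show ?thesis
          using y t by (simp flip: ennreal_mult)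
      qed
      finally show ?thesis
        using True t by (simp add: ennreal_mult)
    qed auto
  qed
  also have "\<dots> = ennreal (t * pi) * ennreal ((1/\<rho>) powr (t - 2 + 1) / - (t - 2 + 1))"
    using \<rho> t by (subst nn_integral_cmult) (simp_all add: nn_integral_powr_atLeast del: minus_add_distrib)
  also have "\<dots> = ennreal (t * pi / (1 - t) * \<rho> powr (1 - t))"
    using \<rho> t by (simp add: powr_divide powr_minus_divide[of \<rho> "t - 1", simplified] flip: ennreal_mult)
  also have "(\<integral>\<^sup>+u. ennreal (\<rho> powr -t) * indicator D u \<partial>lborel) \<le> ennreal (pi * \<rho> powr (1 - t))"
  proof -
    have "(\<integral>\<^sup>+u. ennreal (\<rho> powr -t) * indicator D u \<partial>lborel) \<le> ennreal (\<rho> powr -t) * ennreal (pi * \<rho>)"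
      using D by (simp add: nn_integral_cmult_indicator mult_left_mono)
    also have "\<dots> = ennreal (pi * \<rho> powr (1 - t))"
      using \<rho> powr_add[of \<rho> "-t" 1] by (simp add: mult_ac add.commute flip: ennreal_mult)
    finally show ?thesis .
  qed
  finally have "(\<integral>\<^sup>+u. ennreal ((\<rho> - (cmod u)\<^sup>2) powr -t) * indicator D u \<partial>lborel)
      \<le> ennreal (pi * \<rho> powr (1 - t)) + ennreal (t * pi / (1 - t) * \<rho> powr (1 - t))"
    by (simp add: add_mono)
  \<comment> \<open>The constants add up as \<open>1 + t/(1 - t) = 1/(1 - t)\<close>.\<close>
  also have "\<dots> = ennreal (pi / (1 - t) * \<rho> powr (1 - t))"
    using t by (simp add: field_simps flip: ennreal_plus)
  finally show ?thesis
    by (simp add: D_def)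
qed

text \<open>Layer-cake again: the set where the truncated distance is at most \<open>y\<close> is
  empty for \<open>y < \<delta>\<close> and otherwise sits in the disc of radius
  \<open>2 * y\<close> about \<open>c\<close>. Its area \<open>4 * pi * y^2\<close> lowers the decay
  \<open>y powr (- 3 - t)\<close> to \<open>y powr (- 1 - t)\<close>, which is integrable at
  infinity because \<open>t > 0\<close>.\<close>

lemma nn_integral_truncated_powr_le:
  fixes \<delta> t :: real and c :: complex
  assumes t: "0 < t" and \<delta>: "0 < \<delta>"
  shows "(\<integral>\<^sup>+u. ennreal ((max \<delta> (cmod (c - u) / 2)) powr (- 2 - t)) \<partial>lborel)
           \<le> ennreal (4 * pi * (2 + t) / t * \<delta> powr -t)"
proof -
  define m where "m u = max \<delta> (cmod (c - u) / 2)" for u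
  have [measurable]: "m \<in> borel_measurable borel"
    unfolding m_def by measurable
  have m: "0 < m u" "\<delta> \<le> m u" for u
    using \<delta> by (auto simp: m_def)
  have layer: "ennreal (m u powr (- 2 - t))
      = (\<integral>\<^sup>+y. ennreal (2 + t) * ennreal (y powr (- 3 - t)) * indicator {m u..} y \<partial>lborel)" for u
  proof -
    have "(\<integral>\<^sup>+y. ennreal (2 + t) * ennreal (y powr (- 3 - t)) * indicator {m u..} y \<partial>lborel)
        = ennreal (2 + t) * ennreal (m u powr (- 3 - t + 1) / - (- 3 - t + 1))"
      using m t by (simp add: nn_integral_cmult nn_integral_powr_atLeast mult.assoc del: minus_add_distrib)
    also have "\<dots> = ennreal (m u powr (- 2 - t))"
      using t by (subst ennreal_mult[symmetric]) (auto simp: field_simps)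
    finally show ?thesis ..
  qed
  have "(\<integral>\<^sup>+u. ennreal (m u powr (- 2 - t)) \<partial>lborel)
      = (\<integral>\<^sup>+y. (\<integral>\<^sup>+u. ennreal (2 + t) * ennreal (y powr (- 3 - t)) * indicator {m u..} y \<partial>lborel) \<partial>lborel)"
    unfolding layer by (rule lborel_pair.Fubini'[symmetric]) (simp add: split_beta' indicator_def)
  also have "\<dots> \<le> (\<integral>\<^sup>+y. ennreal (4 * pi * (2 + t)) * (ennreal (y powr (- 1 - t)) * indicator {\<delta>..} y) \<partial>lborel)"
  proof (intro nn_integral_mono)
    fix y :: real
    show "(\<integral>\<^sup>+u. ennreal (2 + t) * ennreal (y powr (- 3 - t)) * indicator {m u..} y \<partial>lborel)
        \<le> ennreal (4 * pi * (2 + t)) * (ennreal (y powr (- 1 - t)) * indicator {\<delta>..} y)"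
    proof (cases "\<delta> \<le> y")
      case True
      then have y: "0 < y"
        using \<delta> by simp
      have "(\<integral>\<^sup>+u. ennreal (2 + t) * ennreal (y powr (- 3 - t)) * indicator {m u..} y \<partial>lborel)
          \<le> (\<integral>\<^sup>+u. ennreal (2 + t) * ennreal (y powr (- 3 - t)) * indicator (cball c (2 * y)) u \<partial>lborel)"
        by (intro nn_integral_mono mult_left_mono) (auto simp: indicator_def m_def dist_norm)
      also have "\<dots> = ennreal (2 + t) * ennreal (y powr (- 3 - t)) * ennreal (pi * (2 * y)\<^sup>2)"
        using y by (simp add: nn_integral_cmult_indicator emeasure_cball unit_ball_vol_2)
      also have "\<dots> = ennreal (4 * pi * (2 + t) * y powr (- 1 - t))"
      proof -
        have "y powr (- 1 - t) = y powr (- 3 - t) * y\<^sup>2"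
          using y powr_add[of y "- 3 - t" 2] by simp
        then show ?thesis
          using t by (simp add: power_mult_distrib mult_ac flip: ennreal_mult del: ennreal_plus)
      qed
      finally show ?thesis
        using True t by (simp add: ennreal_mult)
    next
      case False
      then have "indicator {m u..} y = (0::ennreal)" for u
        using m(2)[of u] by simp
      then show ?thesis
        by simp
    qed
  qed
  also have "\<dots> = ennreal (4 * pi * (2 + t)) * ennreal (\<delta> powr (- 1 - t + 1) / - (- 1 - t + 1))"
    using \<delta> t by (subst nn_integral_cmult) (simp_all add: nn_integral_powr_atLeast del: minus_add_distrib)
  also have "\<dots> = ennreal (4 * pi * (2 + t) / t * \<delta> powr -t)"
    using t by (simp flip: ennreal_mult)
  finally show ?thesis
    by (simp add: m_def)
qed

text \<open>With \<open>x = |1 - r u|\<close>, the numerator is at most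
  \<open>2 * x powr (1 - t)\<close>, so the integrand is at most
  \<open>2 * x powr (- 2 - t)\<close>. Bounding \<open>x\<close> below by the truncated distance to
  1 reduces the claim to the preceding lemma with \<open>\<delta> = 1 - r\<close>.\<close>

lemma nn_integral_disc_kernel_le:
  fixes r t :: real
  assumes t: "0 < t" "t < 1" and r: "0 \<le> r" "r < 1"
  shows "(\<integral>\<^sup>+u. ennreal ((1 - (cmod u)\<^sup>2) powr (1 - t) / cmod (1 - of_real r * u) ^ 3)
            * indicator {u. (cmod u)\<^sup>2 < 1} u \<partial>lborel)
           \<le> ennreal (8 * pi * (2 + t) / t * (1 - r) powr -t)"
proof -
  define m where "m u = max (1 - r) (cmod (1 - u) / 2)" for u
  have [measurable]: "m \<in> borel_measurable borel"
    unfolding m_def by measurable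
  have "(1 - (cmod u)\<^sup>2) powr (1 - t) / cmod (1 - of_real r * u) ^ 3 \<le> 2 * m u powr (- 2 - t)"
    if "(cmod u)\<^sup>2 < 1" for u
  proof -
    define x where "x = cmod (1 - of_real r * u)"
    have u: "cmod u < 1"
      using that by (simp add: power_less_one_iff abs_square_less_1)
    have ru: "r * cmod u \<le> r" "r * cmod u \<le> cmod u"
      using u r by (auto intro: mult_left_le mult_left_le_one_le)
    have "1 - r * cmod u \<le> x"
      unfolding x_def using norm_triangle_ineq2[of 1 "of_real r * u"] r by (simp add: norm_mult)
    with ru have x1: "1 - r \<le> x" "1 - cmod u \<le> x"
      by auto
    \<comment> \<open>Replacing \<open>r u\<close> by \<open>u\<close> costs at most
      \<open>1 - r\<close>, which is itself at most \<open>x\<close>; this is the source of the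
      factor 1/2 in \<open>m\<close>.\<close>
    have "cmod (1 - u) \<le> x + cmod ((of_real r - 1) * u)"
      unfolding x_def using norm_triangle_ineq[of "1 - of_real r * u" "(of_real r - 1) * u"]
      by (simp add: algebra_simps)
    also have "cmod ((of_real r - 1) * u) = (1 - r) * cmod u"
    proof -
      have "cmod (of_real r - 1) = 1 - r"
        using r norm_of_real[of "r - 1", where 'a=complex] by simp
      then show ?thesis
        by (simp add: norm_mult)
    qed
    also have "\<dots> \<le> 1 - r"
      using u r by (simp add: mult_left_le)
    finally have "cmod (1 - u) / 2 \<le> x"
      using x1 by simp
    with x1 have mx: "m u \<le> x"
      by (simp add: m_def)
    have m0: "0 < m u"
      using r by (simp add: m_def less_max_iff_disj)
    have "1 - (cmod u)\<^sup>2 = (1 + cmod u) * (1 - cmod u)"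
      by (simp add: power2_eq_square algebra_simps)
    also have "\<dots> \<le> 2 * x"
      using u x1 by (intro mult_mono) auto
    finally have "(1 - (cmod u)\<^sup>2) powr (1 - t) \<le> (2 * x) powr (1 - t)"
      using that t by (intro powr_mono2) auto
    also have "\<dots> = 2 powr (1 - t) * x powr (1 - t)"
      using m0 mx by (simp add: powr_mult)
    also have "\<dots> \<le> 2 * x powr (1 - t)"
      using powr_mono[of "1 - t" 1 "2::real"] t by (intro mult_right_mono) auto
    finally have "(1 - (cmod u)\<^sup>2) powr (1 - t) / x ^ 3 \<le> 2 * x powr (1 - t) / x ^ 3"
      using m0 mx by (intro divide_right_mono) auto
    also have "\<dots> = 2 * x powr (- 2 - t)"
      using m0 mx powr_diff[of x "1 - t" 3] by simp
    also have "\<dots> \<le> 2 * m u powr (- 2 - t)"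
      using m0 mx t by (intro mult_left_mono powr_mono2') auto
    finally show ?thesis
      by (simp add: x_def)
  qed
  then have "(\<integral>\<^sup>+u. ennreal ((1 - (cmod u)\<^sup>2) powr (1 - t) / cmod (1 - of_real r * u) ^ 3)
            * indicator {u. (cmod u)\<^sup>2 < 1} u \<partial>lborel) \<le> (\<integral>\<^sup>+u. ennreal 2 * ennreal (m u powr (- 2 - t)) \<partial>lborel)"
    by (intro nn_integral_mono) (auto simp: indicator_def simp flip: ennreal_mult simp del: ennreal_numeral intro!: ennreal_leI)
  also have "\<dots> = ennreal 2 * (\<integral>\<^sup>+u. ennreal (m u powr (- 2 - t)) \<partial>lborel)"
    by (rule nn_integral_cmult) simp
  also have "\<dots> \<le> ennreal 2 * ennreal (4 * pi * (2 + t) / t * (1 - r) powr -t)"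
    unfolding m_def using t r by (intro mult_left_mono nn_integral_truncated_powr_le) auto
  also have "\<dots> = ennreal (2 * (4 * pi * (2 + t) / t * (1 - r) powr -t))"
    using t by (subst ennreal_mult) auto
  finally show ?thesis
    by (simp add: mult.assoc)
qed

subsection \<open>The Forelli--Rudin estimate on the ball\<close>

definition herm2 :: "complex \<times> complex \<Rightarrow> complex \<times> complex \<Rightarrow> complex" where
  "herm2 z w = fst z * cnj (fst w) + snd z * cnj (snd w)"

lemma norm_prod_power2: "(norm z)\<^sup>2 = (norm (fst z))\<^sup>2 + (norm (snd z))\<^sup>2"
  by (simp add: norm_prod_def)

lemma ball2_eq: "ball2 = {z. (norm z)\<^sup>2 < 1}" "ball2 = ball 0 1"
  by (auto simp: ball2_def norm_prod_power2 norm_prod_def)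

text \<open>\<open>U\<close> is the unitary matrix whose first column is \<open>z/|z|\<close>, so
  \<open>z\<close> is \<open>|z|\<close> times the image of the first basis vector, and unitarity
  gives the formula. Only the real orthogonality of \<open>U\<close> is recorded, as this is what
  the invariance of Lebesgue measure requires.\<close>

lemma ex_unitary_to_axis:
  "\<exists>U :: complex \<times> complex \<Rightarrow> complex \<times> complex. orthogonal_transformation U \<and> (\<forall>u. herm2 z (U u) = of_real (norm z) * cnj (fst u))"
proof (cases "z = 0")
  case True
  then show ?thesis
    by (intro exI[of _ "\<lambda>x. x"]) (auto simp: herm2_def orthogonal_transformation_id)
next
  case False
  define a where "a = fst z / of_real (norm z)"
  define b where "b = snd z / of_real (norm z)"
  define U where "U = (\<lambda>u. (a * fst u - cnj b * snd u, b * fst u + cnj a * snd u))"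
  have z: "fst z = of_real (norm z) * a" "snd z = of_real (norm z) * b"
    using False by (auto simp: a_def b_def)
  have ab: "(cmod a)\<^sup>2 + (cmod b)\<^sup>2 = 1"
    using False norm_prod_power2[of z, symmetric]
    by (simp add: a_def b_def norm_divide power_divide flip: add_divide_distrib)
  have aabb: "a * cnj a + b * cnj b = 1"
    using ab by (simp flip: complex_norm_square of_real_add of_real_power)
  have "linear U"
    unfolding U_def by (intro linearI) (auto simp: algebra_simps scaleR_right_diff_distrib)
  moreover have "norm (U u) = norm u" for u
  proof -
    \<comment> \<open>Over the complex numbers the squared norms become polynomials in the entries
      and their conjugates, so the cross terms cancel algebraically.\<close>
    have "complex_of_real ((norm (U u))\<^sup>2) = (a * cnj a + b * cnj b) * complex_of_real ((norm u)\<^sup>2)"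
      unfolding norm_prod_power2 of_real_add complex_norm_square U_def
      by (simp add: algebra_simps)
    then have "(norm (U u))\<^sup>2 = (norm u)\<^sup>2"
      using aabb by (metis mult_1 of_real_eq_iff)
    then show ?thesis
      by simp
  qed
  moreover have "herm2 z (U u) = of_real (norm z) * cnj (fst u)" for u
  proof -
    have "herm2 z (U u) = of_real (norm z) * (a * cnj a + b * cnj b) * cnj (fst u)"
      unfolding herm2_def z U_def by (simp add: algebra_simps)
    then show ?thesis
      using aabb by simp
  qed
  ultimately show ?thesis
    by (auto simp: orthogonal_transformation)
qed

lemma borel_measurable_herm2 [measurable (raw)]:
  assumes [measurable]: "f \<in> borel_measurable M" "g \<in> borel_measurable M"
  shows "(\<lambda>x. herm2 (f x) (g x)) \<in> borel_measurable M"
proof -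
  have "(\<lambda>x. herm2 (fst x) (snd x)) \<in> borel_measurable borel"
    unfolding herm2_def by (intro borel_measurable_continuous_onI continuous_intros)
  then have "(\<lambda>x. (\<lambda>x. herm2 (fst x) (snd x)) (f x, g x)) \<in> borel_measurable M"
    by (rule measurable_compose[rotated]) (intro borel_measurable_Pair; measurable)
  then show ?thesis
    by simp
qed

lemma sets_ball2 [measurable]: "ball2 \<in> sets borel"
  by (simp add: ball2_eq(2))

text \<open>After the rotation the kernel depends on the first coordinate only. The slice over
  \<open>x\<close> is a disc of squared radius \<open>1 - |x|^2\<close>; integrating the weight over
  it raises the exponent from \<open>-t\<close> to \<open>1 - t\<close> and leaves the one-variable
  estimate.\<close>

proposition Forelli_Rudin_estimate:
  assumes t: "0 < t" "t < 1"
  obtains C where "0 \<le> C" and "\<And>z. z \<in> ball2 \<Longrightarrow>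
    (\<integral>\<^sup>+w. ennreal ((1 - (norm w)\<^sup>2) powr -t / cmod (1 - herm2 z w) ^ 3) * indicator ball2 w \<partial>lborel)
      \<le> ennreal (C * (1 - (norm z)\<^sup>2) powr -t)"
proof
  \<comment> \<open>The factors come from the integration over the slices, from the disc estimate,
    and from passing from \<open>1 - r\<close> to \<open>1 - r^2\<close>.\<close>
  define C where "C = pi / (1 - t) * (8 * pi * (2 + t) / t) * 2"
  show "0 \<le> C"
    using t by (simp add: C_def)
  fix z assume "z \<in> ball2"
  define r where "r = norm z"
  have r: "0 \<le> r" "r < 1"
    using \<open>z \<in> ball2\<close> by (auto simp: r_def ball2_eq(2))
  obtain U :: "complex \<times> complex \<Rightarrow> complex \<times> complex"
    where U: "orthogonal_transformation U" "\<And>u. herm2 z (U u) = of_real r * cnj (fst u)"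
    using ex_unitary_to_axis unfolding r_def by blast
  have normU: "norm (U u) = norm u" for u
    using U(1) by (rule orthogonal_transformation_norm)
  define F where "F u = ennreal ((1 - (norm u)\<^sup>2) powr -t / cmod (1 - of_real r * fst u) ^ 3) * indicator ball2 u"
    for u :: "complex \<times> complex"
  have cm: "cmod (1 - of_real r * cnj x) = cmod (1 - of_real r * x)" for x
    using complex_mod_cnj[of "1 - of_real r * x"] by simp
  have [measurable]: "(fst :: complex \<times> complex \<Rightarrow> complex) \<in> borel_measurable borel"
    by (intro borel_measurable_continuous_onI continuous_intros)
  have [measurable]: "(indicator ball2 :: _ \<Rightarrow> ennreal) \<in> borel_measurable borel"
    by (rule borel_measurable_indicator[OF sets_ball2])
  have [measurable]: "F \<in> borel_measurable borel"
    unfolding F_def by measurable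
  have "(\<integral>\<^sup>+w. ennreal ((1 - (norm w)\<^sup>2) powr -t / cmod (1 - herm2 z w) ^ 3) * indicator ball2 w \<partial>lborel)
      = (\<integral>\<^sup>+u. ennreal ((1 - (norm (U u))\<^sup>2) powr -t / cmod (1 - herm2 z (U u)) ^ 3) * indicator ball2 (U u) \<partial>lborel)"
    by (subst nn_integral_lborel_orthogonal_transformation[OF U(1)]) auto
  also have "\<dots> = (\<integral>\<^sup>+u. F u \<partial>lborel)"
    by (intro nn_integral_cong) (simp add: F_def normU U(2) cm ball2_eq(2) indicator_def)
  also have "\<dots> = (\<integral>\<^sup>+x. (\<integral>\<^sup>+y. F (x, y) \<partial>lborel) \<partial>lborel)"
    by (subst lborel.nn_integral_fst) (simp_all add: lborel_prod)
  also have "\<dots> \<le> (\<integral>\<^sup>+x. ennreal (pi / (1 - t)) * (ennreal ((1 - (cmod x)\<^sup>2) powr (1 - t) / cmod (1 - of_real r * x) ^ 3)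
            * indicator {u. (cmod u)\<^sup>2 < 1} x) \<partial>lborel)"
  proof (intro nn_integral_mono)
    fix x :: complex
    define \<rho> where "\<rho> = 1 - (cmod x)\<^sup>2"
    define k where "k = 1 / cmod (1 - of_real r * x) ^ 3"
    have k: "0 \<le> k"
      by (simp add: k_def)
    have F: "F (x, y) = ennreal k * (ennreal ((\<rho> - (cmod y)\<^sup>2) powr -t) * indicator {u. (cmod u)\<^sup>2 < \<rho>} y)" for y
      using k by (auto simp: F_def k_def \<rho>_def ball2_def norm_prod_power2 indicator_def diff_diff_eq
          divide_inverse mult.commute simp flip: ennreal_mult)
    show "(\<integral>\<^sup>+y. F (x, y) \<partial>lborel) \<le> ennreal (pi / (1 - t)) *
        (ennreal ((1 - (cmod x)\<^sup>2) powr (1 - t) / cmod (1 - of_real r * x) ^ 3) * indicator {u. (cmod u)\<^sup>2 < 1} x)"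
    proof (cases "(cmod x)\<^sup>2 < 1")
      case True
      have "(\<integral>\<^sup>+y. F (x, y) \<partial>lborel)
          = ennreal k * (\<integral>\<^sup>+y. ennreal ((\<rho> - (cmod y)\<^sup>2) powr -t) * indicator {u. (cmod u)\<^sup>2 < \<rho>} y \<partial>lborel)"
        unfolding F by (rule nn_integral_cmult) measurable
      also have "\<dots> \<le> ennreal k * ennreal (pi / (1 - t) * \<rho> powr (1 - t))"
        using True t by (intro mult_left_mono nn_integral_disc_boundary_powr_le) (auto simp: \<rho>_def)
      also have "\<dots> = ennreal (pi / (1 - t)) * ennreal (\<rho> powr (1 - t) * k)"
        using k t by (simp add: mult_ac flip: ennreal_mult)
      finally show ?thesis
        using True by (simp add: k_def \<rho>_def)
    next
      case False
      have "F (x, y) = 0" for y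
        using False by (auto simp: F \<rho>_def indicator_def) (smt (verit) zero_le_power2)
      then show ?thesis
        by simp
    qed
  qed
  also have "\<dots> = ennreal (pi / (1 - t)) * (\<integral>\<^sup>+x. ennreal ((1 - (cmod x)\<^sup>2) powr (1 - t) / cmod (1 - of_real r * x) ^ 3)
            * indicator {u. (cmod u)\<^sup>2 < 1} x \<partial>lborel)"
    by (rule nn_integral_cmult) measurable
  also have "\<dots> \<le> ennreal (pi / (1 - t)) * ennreal (8 * pi * (2 + t) / t * (1 - r) powr -t)"
    using t r by (intro mult_left_mono nn_integral_disc_kernel_le) auto
  also have "\<dots> = ennreal (pi / (1 - t) * (8 * pi * (2 + t) / t) * (1 - r) powr -t)"
    using t by (subst ennreal_mult[symmetric]) (auto simp: mult.assoc)
  also have "\<dots> \<le> ennreal (C * (1 - (norm z)\<^sup>2) powr -t)"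
  proof (rule ennreal_leI)
    have "1 - r\<^sup>2 = (1 + r) * (1 - r)"
      by (simp add: power2_eq_square algebra_simps)
    also have "\<dots> \<le> 2 * (1 - r)"
      using r by (intro mult_right_mono) auto
    finally have "(1 - r\<^sup>2) / 2 \<le> 1 - r"
      by simp
    moreover have r2: "0 < 1 - r\<^sup>2"
      using r by (simp add: power_less_one_iff abs_square_less_1)
    ultimately have "(1 - r) powr -t \<le> ((1 - r\<^sup>2) / 2) powr -t"
      using t by (intro powr_mono2') auto
    also have "\<dots> = 2 powr t * (1 - r\<^sup>2) powr -t"
      using r2 by (simp add: powr_divide powr_minus field_simps)
    also have "\<dots> \<le> 2 * (1 - r\<^sup>2) powr -t"
      using powr_mono[of t 1 "2::real"] t by (intro mult_right_mono) auto
    finally have "pi / (1 - t) * (8 * pi * (2 + t) / t) * (1 - r) powr -t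
        \<le> pi / (1 - t) * (8 * pi * (2 + t) / t) * (2 * (1 - r\<^sup>2) powr -t)"
      using t by (intro mult_left_mono) auto
    then show "pi / (1 - t) * (8 * pi * (2 + t) / t) * (1 - r) powr -t \<le> C * (1 - (norm z)\<^sup>2) powr -t"
      unfolding C_def r_def by (simp only: mult.assoc)
  qed
  finally show "(\<integral>\<^sup>+w. ennreal ((1 - (norm w)\<^sup>2) powr -t / cmod (1 - herm2 z w) ^ 3) * indicator ball2 w \<partial>lborel)
      \<le> ennreal (C * (1 - (norm z)\<^sup>2) powr -t)" .
qed

subsection \<open>The Schur test\<close>

text \<open>Optimising over \<open>s\<close> recovers the multiplicative form of Hoelder's
  inequality: at \<open>s = (H / a) powr (1 / (p * q))\<close> the quantities
  \<open>s powr p * a\<close> and \<open>s powr -q * H\<close> both equal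
  \<open>H powr (1/q) * a powr (1/p)\<close>.\<close>

lemma powr_le_of_Young_family:
  fixes p q a x H :: real
  assumes pq: "1 < p" "1 < q" "1 / p + 1 / q = 1" and "0 \<le> a" "0 < H" "0 \<le> x"
    and bound: "\<And>s. 0 < s \<Longrightarrow> x \<le> s powr p / p * a + s powr -q / q * H"
  shows "x powr p \<le> H powr (p / q) * a"
proof (cases "a = 0")
  case True
  have "x = 0"
  proof (rule ccontr)
    assume "x \<noteq> 0"
    with \<open>0 \<le> x\<close> have x: "0 < x"
      by simp
    \<comment> \<open>For \<open>a = 0\<close> only the second term survives, and this
      \<open>s\<close> makes it equal to \<open>x / q\<close>, which contradicts
      \<open>q > 1\<close>.\<close>
    with bound[of "(x / H) powr (-1/q)"] \<open>0 < H\<close> pq True have "x \<le> x / q"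
      by (simp add: powr_powr)
    with x pq show False
      by (simp add: field_simps)
  qed
  with True show ?thesis
    by simp
next
  case False
  with \<open>0 \<le> a\<close> have a: "0 < a"
    by simp
  have conj: "1 - 1 / q = 1 / p" "1 - 1 / p = 1 / q"
    using pq(3) by linarith+
  define s where "s = (H / a) powr (1 / (p * q))"
  have s: "0 < s"
    using a \<open>0 < H\<close> by (simp add: s_def)
  have sp: "s powr p * a = H powr (1/q) * a powr (1/p)"
  proof -
    have "s powr p * a = H powr (1/q) * (a powr 1 / a powr (1/q))"
      using pq a \<open>0 < H\<close> by (simp add: s_def powr_powr powr_divide)
    also have "a powr 1 / a powr (1/q) = a powr (1/p)"
      unfolding powr_diff[symmetric] conj ..
    finally show ?thesis .
  qed
  have sq: "s powr -q * H = H powr (1/q) * a powr (1/p)"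
  proof -
    have "s powr -q = (H / a) powr -(1/p)"
      using pq by (simp add: s_def powr_powr)
    then have "s powr -q * H = (H powr 1 / H powr (1/p)) * a powr (1/p)"
      using \<open>0 < H\<close> by (simp add: powr_divide powr_minus)
    also have "H powr 1 / H powr (1/p) = H powr (1/q)"
      unfolding powr_diff[symmetric] conj ..
    finally show ?thesis .
  qed
  have "x \<le> (s powr p * a) / p + (s powr -q * H) / q"
    using bound[OF s] by simp
  also have "\<dots> = H powr (1/q) * a powr (1/p) * (1/p + 1/q)"
    unfolding sp sq by (simp add: algebra_simps)
  finally have "x \<le> H powr (1/q) * a powr (1/p)"
    using pq by simp
  then have "x powr p \<le> (H powr (1/q) * a powr (1/p)) powr p"
    using pq \<open>0 \<le> x\<close> by (intro powr_mono2) auto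
  also have "\<dots> = H powr (p / q) * a"
    using pq a by (simp add: powr_mult powr_powr)
  finally show ?thesis .
qed

text \<open>Hoelder's inequality for the measure with density \<open>k\<close>, applied to
  \<open>g = (g / h) * h\<close>. Young's inequality is used pointwise with a free scaling
  \<open>s\<close>, and the optimisation over \<open>s\<close> takes place after
  integration.\<close>

lemma nn_integral_weighted_Hoelder:
  fixes k g h :: "'a \<Rightarrow> real" and p q H :: real
  assumes pq: "1 < p" "1 < q" "1 / p + 1 / q = 1"
    and [measurable]: "k \<in> borel_measurable M" "g \<in> borel_measurable M" "h \<in> borel_measurable M"
    and k: "\<And>w. 0 \<le> k w" and g: "\<And>w. 0 \<le> g w" and h: "\<And>w. 0 < h w" and "0 < H"
    and H: "(\<integral>\<^sup>+w. ennreal (k w * h w powr q) \<partial>M) \<le> ennreal H"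
    and fin: "(\<integral>\<^sup>+w. ennreal (k w * (g w / h w) powr p) \<partial>M) < \<infinity>"
  shows "(\<integral>\<^sup>+w. ennreal (k w * g w) \<partial>M) < \<infinity>"
    and "ennreal (enn2real (\<integral>\<^sup>+w. ennreal (k w * g w) \<partial>M) powr p)
          \<le> ennreal (H powr (p / q)) * (\<integral>\<^sup>+w. ennreal (k w * (g w / h w) powr p) \<partial>M)"
proof -
  define X where "X = (\<integral>\<^sup>+w. ennreal (k w * g w) \<partial>M)"
  define a where "a = enn2real (\<integral>\<^sup>+w. ennreal (k w * (g w / h w) powr p) \<partial>M)"
  have a: "0 \<le> a" "(\<integral>\<^sup>+w. ennreal (k w * (g w / h w) powr p) \<partial>M) = ennreal a"
    using fin by (auto simp: a_def)
  have bound: "X \<le> ennreal (s powr p / p * a + s powr -q / q * H)" if s: "0 < s" for s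
  proof -
    have "k w * g w \<le> s powr p / p * (k w * (g w / h w) powr p) + s powr -q / q * (k w * h w powr q)" for w
    proof -
      have "(s * (g w / h w)) * (h w / s) \<le> (s * (g w / h w)) powr p / p + (h w / s) powr q / q"
        using s g h[of w] pq by (intro Youngs_inequality) (auto simp: less_imp_le)
      also have "(s * (g w / h w)) * (h w / s) = g w"
        using s h[of w] by simp
      also have "(s * (g w / h w)) powr p = s powr p * (g w / h w) powr p"
        by (rule powr_mult)
      also have "(h w / s) powr q = s powr -q * h w powr q"
        using s h[of w] by (simp add: powr_divide powr_minus field_simps)
      finally have "k w * g w \<le> k w * (s powr p * (g w / h w) powr p / p + s powr -q * h w powr q / q)"
        using k by (intro mult_left_mono) auto
      then show ?thesis
        by (simp add: algebra_simps)
    qed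
    then have "X \<le> (\<integral>\<^sup>+w. ennreal (s powr p / p) * ennreal (k w * (g w / h w) powr p)
        + ennreal (s powr -q / q) * ennreal (k w * h w powr q) \<partial>M)"
      unfolding X_def using k pq
      by (intro nn_integral_mono) (simp flip: ennreal_mult ennreal_plus add: ennreal_leI)
    also have "\<dots> = ennreal (s powr p / p) * ennreal a
        + ennreal (s powr -q / q) * (\<integral>\<^sup>+w. ennreal (k w * h w powr q) \<partial>M)"
      by (simp add: nn_integral_add nn_integral_cmult a)
    also have "\<dots> \<le> ennreal (s powr p / p) * ennreal a + ennreal (s powr -q / q) * ennreal H"
      using H by (intro add_left_mono mult_left_mono) auto
    also have "\<dots> = ennreal (s powr p / p * a + s powr -q / q * H)"
      using a \<open>0 < H\<close> pq by (simp flip: ennreal_mult ennreal_plus)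
    finally show ?thesis .
  qed
  have "X < \<infinity>"
    using bound[of 1] by (auto intro: le_less_trans)
  then show "(\<integral>\<^sup>+w. ennreal (k w * g w) \<partial>M) < \<infinity>"
    by (simp add: X_def)
  have "enn2real X \<le> s powr p / p * a + s powr -q / q * H" if "0 < s" for s
    using enn2real_mono[OF bound[OF that]] a \<open>0 < H\<close> pq by (simp del: ennreal_plus)
  then have "enn2real X powr p \<le> H powr (p / q) * a"
    using a pq \<open>0 < H\<close> by (intro powr_le_of_Young_family) auto
  then show "ennreal (enn2real (\<integral>\<^sup>+w. ennreal (k w * g w) \<partial>M) powr p)
      \<le> ennreal (H powr (p / q)) * (\<integral>\<^sup>+w. ennreal (k w * (g w / h w) powr p) \<partial>M)"
    using a by (simp add: X_def[symmetric] ennreal_leI flip: ennreal_mult)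
qed

text \<open>Hoelder with the weight \<open>h\<close> and \<open>hq\<close> bound the operator
  pointwise by \<open>h z powr p * A z\<close>; integrating in \<open>z\<close>, exchanging the
  integrals and using \<open>hp\<close> gives back the norm of \<open>g\<close>. The almost
  everywhere finiteness is stated separately because \<open>enn2real\<close> sends infinity to
  0.\<close>

proposition Schur_test:
  fixes k :: "'a \<Rightarrow> 'a \<Rightarrow> real" and h g :: "'a \<Rightarrow> real" and p q C D :: real
  assumes "sigma_finite_measure M"
    and pq: "1 < p" "1 < q" "1 / p + 1 / q = 1"
    and k_meas: "case_prod k \<in> borel_measurable (M \<Otimes>\<^sub>M M)"
    and h_meas [measurable]: "h \<in> borel_measurable M"
    and k: "\<And>z w. 0 \<le> k z w" and h: "\<And>z. 0 < h z" and C: "0 < C" and D: "0 \<le> D"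
    and hq: "\<And>z. z \<in> space M \<Longrightarrow> (\<integral>\<^sup>+w. ennreal (k z w * h w powr q) \<partial>M) \<le> ennreal (C * h z powr q)"
    and hp: "\<And>w. w \<in> space M \<Longrightarrow> (\<integral>\<^sup>+z. ennreal (k z w * h z powr p) \<partial>M) \<le> ennreal (D * h w powr p)"
    and g_meas [measurable]: "g \<in> borel_measurable M" and g: "\<And>w. 0 \<le> g w"
    and fin: "(\<integral>\<^sup>+w. ennreal (g w powr p) \<partial>M) < \<infinity>"
  shows "AE z in M. (\<integral>\<^sup>+w. ennreal (k z w * g w) \<partial>M) < \<infinity>"
    and "(\<integral>\<^sup>+z. ennreal (enn2real (\<integral>\<^sup>+w. ennreal (k z w * g w) \<partial>M) powr p) \<partial>M)
          \<le> ennreal (C powr (p / q) * D) * (\<integral>\<^sup>+w. ennreal (g w powr p) \<partial>M)"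
proof -
  interpret sigma_finite_measure M by fact
  interpret pair_sigma_finite M M ..
  note [measurable] = k_meas
  define A where "A z = (\<integral>\<^sup>+w. ennreal (k z w * (g w / h w) powr p) \<partial>M)" for z
  have [measurable]: "A \<in> borel_measurable M"
    unfolding A_def by measurable
  have A_int: "(\<integral>\<^sup>+z. ennreal (h z powr p) * A z \<partial>M) \<le> ennreal D * (\<integral>\<^sup>+w. ennreal (g w powr p) \<partial>M)"
  proof -
    have "(\<integral>\<^sup>+z. ennreal (h z powr p) * A z \<partial>M)
        = (\<integral>\<^sup>+z. (\<integral>\<^sup>+w. ennreal ((g w / h w) powr p) * ennreal (k z w * h z powr p) \<partial>M) \<partial>M)"
    proof (rule nn_integral_cong)
      fix z assume [measurable]: "z \<in> space M"
      have "ennreal (h z powr p) * A z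
          = (\<integral>\<^sup>+w. ennreal (h z powr p) * ennreal (k z w * (g w / h w) powr p) \<partial>M)"
        unfolding A_def by (rule nn_integral_cmult[symmetric]) measurable
      also have "\<dots> = (\<integral>\<^sup>+w. ennreal ((g w / h w) powr p) * ennreal (k z w * h z powr p) \<partial>M)"
        by (intro nn_integral_cong) (simp add: k mult_ac flip: ennreal_mult)
      finally show "ennreal (h z powr p) * A z
          = (\<integral>\<^sup>+w. ennreal ((g w / h w) powr p) * ennreal (k z w * h z powr p) \<partial>M)" .
    qed
    also have "\<dots> = (\<integral>\<^sup>+w. (\<integral>\<^sup>+z. ennreal ((g w / h w) powr p) * ennreal (k z w * h z powr p) \<partial>M) \<partial>M)"
      by (rule Fubini'[symmetric]) measurable
    also have "\<dots> \<le> (\<integral>\<^sup>+w. ennreal D * ennreal (g w powr p) \<partial>M)"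
    proof (rule nn_integral_mono)
      fix w assume w [measurable]: "w \<in> space M"
      have "(\<integral>\<^sup>+z. ennreal ((g w / h w) powr p) * ennreal (k z w * h z powr p) \<partial>M)
          = ennreal ((g w / h w) powr p) * (\<integral>\<^sup>+z. ennreal (k z w * h z powr p) \<partial>M)"
        by (rule nn_integral_cmult) measurable
      also have "\<dots> \<le> ennreal ((g w / h w) powr p) * ennreal (D * h w powr p)"
        using hp[OF w] by (intro mult_left_mono) auto
      also have "\<dots> = ennreal D * ennreal (g w powr p)"
        using D g[of w] h[of w] by (simp add: powr_divide flip: ennreal_mult)
      finally show "(\<integral>\<^sup>+z. ennreal ((g w / h w) powr p) * ennreal (k z w * h z powr p) \<partial>M)
          \<le> ennreal D * ennreal (g w powr p)" .
    qed
    also have "\<dots> = ennreal D * (\<integral>\<^sup>+w. ennreal (g w powr p) \<partial>M)"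
      by (rule nn_integral_cmult) measurable
    finally show ?thesis .
  qed
  also have "\<dots> < \<infinity>"
    using fin by (simp add: ennreal_mult_less_top)
  \<comment> \<open>A finite integral forces finiteness almost everywhere, and the positive factor
    \<open>h z powr p\<close> can then be dropped.\<close>
  finally have "AE z in M. ennreal (h z powr p) * A z \<noteq> \<infinity>"
    by (intro nn_integral_PInf_AE) auto
  then have A_fin: "AE z in M. A z < \<infinity>"
  proof eventually_elim
    case (elim z)
    have "ennreal (h z powr p) \<noteq> 0"
      using h[of z] by simp
    with elim show ?case
      by (auto simp: ennreal_mult_eq_top_iff less_top)
  qed
  have H: "(\<integral>\<^sup>+w. ennreal (k z w * g w) \<partial>M) < \<infinity> \<and>
      ennreal (enn2real (\<integral>\<^sup>+w. ennreal (k z w * g w) \<partial>M) powr p)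
        \<le> ennreal (C powr (p / q)) * (ennreal (h z powr p) * A z)"
    if [measurable]: "z \<in> space M" and "A z < \<infinity>" for z
  proof -
    have "0 < C * h z powr q"
      using C h[of z] by simp
    then have "(\<integral>\<^sup>+w. ennreal (k z w * g w) \<partial>M) < \<infinity>"
      and "ennreal (enn2real (\<integral>\<^sup>+w. ennreal (k z w * g w) \<partial>M) powr p)
        \<le> ennreal ((C * h z powr q) powr (p / q)) * A z"
      using nn_integral_weighted_Hoelder[OF pq, of "k z" M g h "C * h z powr q"] that hq[OF that(1)] k g h
      by (simp_all add: A_def)
    moreover have "ennreal ((C * h z powr q) powr (p / q)) = ennreal (C powr (p / q)) * ennreal (h z powr p)"
      using C pq by (simp add: powr_mult powr_powr ennreal_mult)
    ultimately show ?thesis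
      by (simp add: mult.assoc)
  qed
  show "AE z in M. (\<integral>\<^sup>+w. ennreal (k z w * g w) \<partial>M) < \<infinity>"
    using A_fin AE_space by eventually_elim (use H in blast)
  have "AE z in M. ennreal (enn2real (\<integral>\<^sup>+w. ennreal (k z w * g w) \<partial>M) powr p)
        \<le> ennreal (C powr (p / q)) * (ennreal (h z powr p) * A z)"
    using A_fin AE_space by eventually_elim (use H in blast)
  then have "(\<integral>\<^sup>+z. ennreal (enn2real (\<integral>\<^sup>+w. ennreal (k z w * g w) \<partial>M) powr p) \<partial>M)
      \<le> (\<integral>\<^sup>+z. ennreal (C powr (p / q)) * (ennreal (h z powr p) * A z) \<partial>M)"
    by (rule nn_integral_mono_AE)
  also have "\<dots> = ennreal (C powr (p / q)) * (\<integral>\<^sup>+z. ennreal (h z powr p) * A z \<partial>M)"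
    by (rule nn_integral_cmult) measurable
  also have "\<dots> \<le> ennreal (C powr (p / q)) * (ennreal D * (\<integral>\<^sup>+w. ennreal (g w powr p) \<partial>M))"
    by (intro mult_left_mono A_int) auto
  finally show "(\<integral>\<^sup>+z. ennreal (enn2real (\<integral>\<^sup>+w. ennreal (k z w * g w) \<partial>M) powr p) \<partial>M)
          \<le> ennreal (C powr (p / q) * D) * (\<integral>\<^sup>+w. ennreal (g w powr p) \<partial>M)"
    using D by (simp add: ennreal_mult mult.assoc)
qed

subsection \<open>The twisted kernel\<close>

lemma cube_inverse_diff:
  fixes A B :: complex
  assumes "A - B \<noteq> 0" "A + B \<noteq> 0"
  shows "1 / (A - B) ^ 3 - 1 / (A + B) ^ 3 = 2 * B * (3 * A\<^sup>2 + B\<^sup>2) / ((A - B) ^ 3 * (A + B) ^ 3)"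
proof -
  have "1 / (A - B) ^ 3 - 1 / (A + B) ^ 3 = ((A + B) ^ 3 - (A - B) ^ 3) / ((A - B) ^ 3 * (A + B) ^ 3)"
    using assms by (simp add: diff_frac_eq)
  also have "(A + B) ^ 3 - (A - B) ^ 3 = 2 * B * (3 * A\<^sup>2 + B\<^sup>2)"
    by (simp add: power2_eq_square power3_eq_cube algebra_simps)
  finally show ?thesis .
qed

text \<open>With \<open>s\<close> the larger of \<open>|A - B|\<close> and \<open>|A + B|\<close>,
  the numerator is at most \<open>2 * s * 4 * s^2\<close>, hence at most 8 times the sum of the two
  cubes. Dividing by their product separates the two singularities.\<close>

lemma three_square_cube_bound:
  fixes A B :: complex and m :: real
  assumes nz: "A - B \<noteq> 0" "A + B \<noteq> 0" and m: "0 \<le> m" "m \<le> 2 * cmod A"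
  shows "m * cmod (3 * A\<^sup>2 + B\<^sup>2) / (cmod (A - B) ^ 3 * cmod (A + B) ^ 3)
           \<le> 8 * (1 / cmod (A - B) ^ 3 + 1 / cmod (A + B) ^ 3)"
proof -
  define x where "x = cmod (A - B)"
  define y where "y = cmod (A + B)"
  define s where "s = max x y"
  have xy: "0 < x" "0 < y"
    using nz by (auto simp: x_def y_def)
  have "2 * cmod A = cmod ((A - B) + (A + B))" "2 * cmod B = cmod ((A + B) - (A - B))"
    using norm_mult[of 2 A] norm_mult[of 2 B] by simp_all
  then have "2 * cmod A \<le> x + y" "2 * cmod B \<le> x + y"
    using norm_triangle_ineq[of "A - B" "A + B"] norm_triangle_ineq4[of "A + B" "A - B"]
    by (simp_all add: x_def y_def)
  then have AB: "cmod A \<le> s" "cmod B \<le> s"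
    by (auto simp: s_def)
  have "cmod (3 * A\<^sup>2 + B\<^sup>2) \<le> 3 * (cmod A)\<^sup>2 + (cmod B)\<^sup>2"
    using norm_triangle_ineq[of "3 * A\<^sup>2" "B\<^sup>2"] by (simp add: norm_mult norm_power)
  also have "\<dots> \<le> 3 * s\<^sup>2 + s\<^sup>2"
    using AB by (intro add_mono mult_left_mono power_mono) auto
  finally have "m * cmod (3 * A\<^sup>2 + B\<^sup>2) \<le> (2 * s) * (4 * s\<^sup>2)"
    using m AB by (intro mult_mono) auto
  also have "\<dots> = 8 * s ^ 3"
    by (simp add: power2_eq_square power3_eq_cube)
  also have "s ^ 3 \<le> x ^ 3 + y ^ 3"
    using xy by (auto simp: s_def max_def)
  finally have "m * cmod (3 * A\<^sup>2 + B\<^sup>2) / (x ^ 3 * y ^ 3) \<le> 8 * (x ^ 3 + y ^ 3) / (x ^ 3 * y ^ 3)"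
    using xy by (intro divide_right_mono) auto
  also have "\<dots> = 8 * (1 / x ^ 3 + 1 / y ^ 3)"
    using xy by (simp add: field_simps)
  finally show ?thesis
    by (simp add: x_def y_def)
qed

text \<open>Young's inequality for \<open>a^2\<close> and \<open>b^2\<close> with weights
  \<open>1/p\<close> and \<open>1 - 1/p\<close>. These weights are at most 1, which makes the bound
  uniform in \<open>p\<close>.\<close>

lemma powr_conjugate_product_le:
  fixes a b p :: real
  assumes "0 \<le> a" "0 \<le> b" "1 < p"
  shows "a powr (2 / p) * b powr (2 - 2 / p) \<le> a\<^sup>2 + b\<^sup>2"
proof (cases "a = 0 \<or> b = 0")
  case False
  then have ab: "0 < a" "0 < b"
    using assms by auto
  have "a powr (2 / p) * b powr (2 - 2 / p) = (a\<^sup>2) powr (1 / p) * (b\<^sup>2) powr (1 - 1 / p)"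
    using ab by (simp add: powr_powr right_diff_distrib flip: powr_numeral)
  also have "\<dots> \<le> 1 / p * a\<^sup>2 + (1 - 1 / p) * b\<^sup>2"
    using ab assms by (intro Youngs_inequality_0) auto
  also have "\<dots> \<le> a\<^sup>2 + b\<^sup>2"
    using assms by (intro add_mono mult_left_le_one_le) auto
  finally show ?thesis .
qed auto

lemma borel_measurable_cnj [measurable]: "cnj \<in> borel_measurable borel"
  by (intro borel_measurable_continuous_onI continuous_intros)

lemma borel_measurable_K_Gp [measurable]:
  "case_prod (K_Gp p) \<in> borel_measurable (borel \<Otimes>\<^sub>M borel)"
  unfolding K_Gp_def K_G_def bergman_B2_def refl_r_def split_beta' borel_prod[symmetric] fst_conv snd_conv
  by measurable

lemma norm_refl_r [simp]: "norm (refl_r z) = norm z"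
  by (simp add: refl_r_def norm_prod_def)

lemma refl_r_in_ball2 [simp]: "refl_r z \<in> ball2 \<longleftrightarrow> z \<in> ball2"
  by (simp add: ball2_eq(2))

lemma herm2_ne_1:
  assumes "z \<in> ball2" "w \<in> ball2"
  shows "1 - herm2 z w \<noteq> 0"
proof -
  have "cmod (herm2 z w) \<le> cmod (fst z) * cmod (fst w) + cmod (snd z) * cmod (snd w)"
    unfolding herm2_def
    using norm_triangle_ineq[of "fst z * cnj (fst w)" "snd z * cnj (snd w)"] by (simp add: norm_mult)
  also have "2 * \<dots> \<le> (norm z)\<^sup>2 + (norm w)\<^sup>2"
    unfolding norm_prod_power2
    using sum_squares_bound[of "cmod (fst z)" "cmod (fst w)"] sum_squares_bound[of "cmod (snd z)" "cmod (snd w)"]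
    by simp
  also have "\<dots> < 2"
    using assms by (simp add: ball2_eq(1))
  finally have "cmod (herm2 z w) < 1"
    by simp
  then show ?thesis
    by auto
qed

text \<open>The factor \<open>B\<close> in the numerator of \<open>K_G\<close> supplies one power
  each of \<open>|z_1|\<close> and \<open>|w_1|\<close>, which turns the possibly negative exponents
  of the twist into positive ones. The constant is \<open>2 / pi\<^sup>2\<close> from the Bergman
  kernel times the 8 of the cube bound.\<close>

lemma K_Gp_bound:
  assumes "1 < p" "z \<in> ball2" "w \<in> ball2"
  shows "cmod (K_Gp p z w)
    \<le> 16 / pi\<^sup>2 * (1 / cmod (1 - herm2 z w) ^ 3 + 1 / cmod (1 - herm2 (refl_r z) w) ^ 3)"
proof -
  define A where "A = 1 - snd z * cnj (snd w)"
  define B where "B = fst z * cnj (fst w)"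
  define m where "m = cmod (fst z) powr (2 / p) * cmod (fst w) powr (2 - 2 / p)"
  have AB: "A - B = 1 - herm2 z w" "A + B = 1 - herm2 (refl_r z) w"
    by (simp_all add: A_def B_def herm2_def refl_r_def)
  then have nz: "A - B \<noteq> 0" "A + B \<noteq> 0"
    using herm2_ne_1 assms by auto
  have "bergman_B2 z w = of_real (2 / pi\<^sup>2) / (A - B) ^ 3"
    "bergman_B2 z (refl_r w) = of_real (2 / pi\<^sup>2) / (A + B) ^ 3"
    by (simp_all add: bergman_B2_def refl_r_def A_def B_def algebra_simps)
  then have "K_G z w = of_real (2 / pi\<^sup>2) / 2 * (1 / (A - B) ^ 3 - 1 / (A + B) ^ 3)"
    by (simp add: K_G_def diff_divide_distrib right_diff_distrib)
  also have "\<dots> = of_real (2 / pi\<^sup>2) * (B * (3 * A\<^sup>2 + B\<^sup>2) / ((A - B) ^ 3 * (A + B) ^ 3))"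
    unfolding cube_inverse_diff[OF nz] by simp
  finally have "cmod (K_Gp p z w) = cmod (fst z) powr (2 / p - 1) * cmod (fst w) powr (1 - 2 / p) * cmod B
      * (2 / pi\<^sup>2 * (cmod (3 * A\<^sup>2 + B\<^sup>2) / (cmod (A - B) ^ 3 * cmod (A + B) ^ 3)))"
    unfolding K_Gp_def by (simp add: norm_mult norm_divide norm_power)
  also have "cmod (fst z) powr (2 / p - 1) * cmod (fst w) powr (1 - 2 / p) * cmod B
      = (cmod (fst z) * cmod (fst z) powr (2 / p - 1)) * (cmod (fst w) * cmod (fst w) powr (1 - 2 / p))"
    by (simp add: B_def norm_mult)
  \<comment> \<open>This also holds when a first coordinate vanishes: \<open>0 powr e = 0\<close>,
    so both sides are then 0.\<close>
  also have "\<dots> = m"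
    by (simp add: m_def powr_mult_base)
  also have "m * (2 / pi\<^sup>2 * (cmod (3 * A\<^sup>2 + B\<^sup>2) / (cmod (A - B) ^ 3 * cmod (A + B) ^ 3)))
      = 2 / pi\<^sup>2 * (m * cmod (3 * A\<^sup>2 + B\<^sup>2) / (cmod (A - B) ^ 3 * cmod (A + B) ^ 3))"
    by simp
  also have "\<dots> \<le> 2 / pi\<^sup>2 * (8 * (1 / cmod (A - B) ^ 3 + 1 / cmod (A + B) ^ 3))"
  proof (intro mult_left_mono three_square_cube_bound nz)
    have "m \<le> (cmod (fst z))\<^sup>2 + (cmod (fst w))\<^sup>2"
      unfolding m_def using assms by (intro powr_conjugate_product_le) auto
    also have "\<dots> \<le> (1 - (cmod (snd z))\<^sup>2) + (1 - (cmod (snd w))\<^sup>2)"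
      using assms by (simp add: ball2_def)
    also have "\<dots> \<le> 2 * (1 - cmod (snd z) * cmod (snd w))"
      using sum_squares_bound[of "cmod (snd z)" "cmod (snd w)"] by simp
    also have "1 - cmod (snd z) * cmod (snd w) \<le> cmod A"
      using norm_triangle_ineq2[of 1 "snd z * cnj (snd w)"] by (simp add: A_def norm_mult)
    finally show "m \<le> 2 * cmod A"
      by simp
  qed (auto simp: m_def)
  finally show ?thesis
    by (simp add: AB)
qed

section \<open>Weighted estimates for the twisted kernel\<close>

lemma cmod_herm2_commute: "cmod (1 - herm2 z w) = cmod (1 - herm2 w z)"
proof -
  have "cnj (1 - herm2 z w) = 1 - herm2 w z"
    by (simp add: herm2_def mult.commute)
  then show ?thesis
    by (metis complex_mod_cnj)
qed

lemma herm2_refl_r: "herm2 (refl_r z) w = herm2 z (refl_r w)"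
  by (simp add: herm2_def refl_r_def)

text \<open>These are the two hypotheses of the Schur test. The twist treats \<open>z\<close> and
  \<open>w\<close> differently, but the dominating kernel of \<open>K_Gp_bound\<close> is symmetric,
  so the single estimate \<open>est\<close> serves both orders of the arguments.\<close>

lemma K_Gp_weighted_estimate:
  assumes t: "0 < t" "t < 1" and p: "1 < p"
  obtains C where "0 < C"
    and "\<And>z. z \<in> ball2 \<Longrightarrow>
      (\<integral>\<^sup>+w. ennreal (cmod (K_Gp p z w) * (1 - (norm w)\<^sup>2) powr -t) * indicator ball2 w \<partial>lborel)
        \<le> ennreal (C * (1 - (norm z)\<^sup>2) powr -t)"
    and "\<And>z. z \<in> ball2 \<Longrightarrow>
      (\<integral>\<^sup>+w. ennreal (cmod (K_Gp p w z) * (1 - (norm w)\<^sup>2) powr -t) * indicator ball2 w \<partial>lborel)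
        \<le> ennreal (C * (1 - (norm z)\<^sup>2) powr -t)"
proof -
  from Forelli_Rudin_estimate[OF t] obtain C where C: "0 \<le> C" and FR: "\<And>z. z \<in> ball2 \<Longrightarrow>
    (\<integral>\<^sup>+w. ennreal ((1 - (norm w)\<^sup>2) powr -t / cmod (1 - herm2 z w) ^ 3) * indicator ball2 w \<partial>lborel)
      \<le> ennreal (C * (1 - (norm z)\<^sup>2) powr -t)"
    by blast
  define c where "c = 16 / pi\<^sup>2"
  have c: "0 \<le> c"
    by (simp add: c_def)
  have est: "(\<integral>\<^sup>+w. ennreal (K w * (1 - (norm w)\<^sup>2) powr -t) * indicator ball2 w \<partial>lborel)
      \<le> ennreal ((2 * c * C + 1) * (1 - (norm z)\<^sup>2) powr -t)"
    if z: "z \<in> ball2" and K: "\<And>w. w \<in> ball2 \<Longrightarrow>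
      K w \<le> c * (1 / cmod (1 - herm2 z w) ^ 3 + 1 / cmod (1 - herm2 (refl_r z) w) ^ 3)" for z K
  proof -
    define F where "F z w = ennreal ((1 - (norm w)\<^sup>2) powr -t / cmod (1 - herm2 z w) ^ 3) * indicator ball2 w" for z w
    have [measurable]: "(indicator ball2 :: _ \<Rightarrow> ennreal) \<in> borel_measurable borel"
      by (rule borel_measurable_indicator[OF sets_ball2])
    have [measurable]: "F z \<in> borel_measurable borel" for z
      unfolding F_def by measurable
    have F: "(\<integral>\<^sup>+w. F z w \<partial>lborel) \<le> ennreal (C * (1 - (norm z)\<^sup>2) powr -t)" if "z \<in> ball2" for z
      using FR[OF that] by (simp add: F_def)
    have "(\<integral>\<^sup>+w. ennreal (K w * (1 - (norm w)\<^sup>2) powr -t) * indicator ball2 w \<partial>lborel)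
        \<le> (\<integral>\<^sup>+w. ennreal c * (F z w + F (refl_r z) w) \<partial>lborel)"
    proof (rule nn_integral_mono)
      fix w
      show "ennreal (K w * (1 - (norm w)\<^sup>2) powr -t) * indicator ball2 w \<le> ennreal c * (F z w + F (refl_r z) w)"
      proof (cases "w \<in> ball2")
        case True
        have "K w * (1 - (norm w)\<^sup>2) powr -t
            \<le> c * (1 / cmod (1 - herm2 z w) ^ 3 + 1 / cmod (1 - herm2 (refl_r z) w) ^ 3) * (1 - (norm w)\<^sup>2) powr -t"
          using K[OF True] by (intro mult_right_mono) auto
        also have "\<dots> = c * ((1 - (norm w)\<^sup>2) powr -t / cmod (1 - herm2 z w) ^ 3
            + (1 - (norm w)\<^sup>2) powr -t / cmod (1 - herm2 (refl_r z) w) ^ 3)"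
          by (simp add: algebra_simps)
        finally show ?thesis
          using True c by (simp add: F_def ennreal_leI flip: ennreal_plus ennreal_mult)
      qed simp
    qed
    also have "\<dots> = ennreal c * ((\<integral>\<^sup>+w. F z w \<partial>lborel) + (\<integral>\<^sup>+w. F (refl_r z) w \<partial>lborel))"
      by (simp add: nn_integral_cmult nn_integral_add)
    also have "\<dots> \<le> ennreal c * (ennreal (C * (1 - (norm z)\<^sup>2) powr -t) + ennreal (C * (1 - (norm z)\<^sup>2) powr -t))"
      using F[OF z] F[of "refl_r z"] z by (intro mult_left_mono add_mono) auto
    also have "\<dots> = ennreal (2 * c * C * (1 - (norm z)\<^sup>2) powr -t)"
      using c C by (simp flip: ennreal_plus ennreal_mult)
    also have "\<dots> \<le> ennreal ((2 * c * C + 1) * (1 - (norm z)\<^sup>2) powr -t)"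
      by (intro ennreal_leI mult_right_mono) auto
    finally show ?thesis .
  qed
  show thesis
  proof
    \<comment> \<open>The summand 1 makes the constant strictly positive, as the Schur test demands
      of its first constant.\<close>
    show "0 < 2 * c * C + 1"
      using c C by (intro add_nonneg_pos) auto
    fix z assume z: "z \<in> ball2"
    show "(\<integral>\<^sup>+w. ennreal (cmod (K_Gp p z w) * (1 - (norm w)\<^sup>2) powr -t) * indicator ball2 w \<partial>lborel)
        \<le> ennreal ((2 * c * C + 1) * (1 - (norm z)\<^sup>2) powr -t)"
      using K_Gp_bound[OF p z] by (intro est z) (simp add: c_def)
    show "(\<integral>\<^sup>+w. ennreal (cmod (K_Gp p w z) * (1 - (norm w)\<^sup>2) powr -t) * indicator ball2 w \<partial>lborel)
        \<le> ennreal ((2 * c * C + 1) * (1 - (norm z)\<^sup>2) powr -t)"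
    proof (intro est z)
      fix w assume "w \<in> ball2"
      moreover have "cmod (1 - herm2 w z) = cmod (1 - herm2 z w)"
        by (rule cmod_herm2_commute)
      moreover have "cmod (1 - herm2 (refl_r w) z) = cmod (1 - herm2 (refl_r z) w)"
        unfolding herm2_refl_r[of z] by (rule cmod_herm2_commute)
      ultimately show "cmod (K_Gp p w z) \<le> c * (1 / cmod (1 - herm2 z w) ^ 3 + 1 / cmod (1 - herm2 (refl_r z) w) ^ 3)"
        using K_Gp_bound[OF p, of w z] z
        by (simp add: c_def)
    qed
  qed
qed

section \<open>Boundedness of the twisted operator on \<open>L^p\<close>\<close>

theorem theoremA1:
  fixes p :: real
  assumes "1 < p"
  shows "\<exists>C::real. 0 \<le> C \<and>
    (\<forall>f :: complex \<times> complex \<Rightarrow> complex.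
       f \<in> borel_measurable lebesgue \<longrightarrow>
       (\<integral>\<^sup>+ w\<in>ball2. ennreal (cmod (f w) powr p) \<partial>lebesgue) < \<infinity> \<longrightarrow>
       (AE z in lebesgue. z \<in> ball2 \<longrightarrow>
          set_integrable lebesgue ball2 (\<lambda>w. cmod (K_Gp p z w) *\<^sub>R f w)) \<and>
       (\<integral>\<^sup>+ z\<in>ball2. ennreal (cmod (LINT w:ball2|lebesgue. cmod (K_Gp p z w) *\<^sub>R f w) powr p)
            \<partial>lebesgue)
         \<le> ennreal (C powr p) * (\<integral>\<^sup>+ w\<in>ball2. ennreal (cmod (f w) powr p) \<partial>lebesgue))"
proof -
  define q where "q = p / (p - 1)"
  have pq: "1 < p" "1 < q" "1 / p + 1 / q = 1"
    using assms by (auto simp: q_def field_simps)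
  \<comment> \<open>On the ball, \<open>h powr q\<close> and \<open>h powr p\<close> have exponents
    \<open>- (1/p)\<close> and \<open>- (1/q)\<close>, both in the Forelli-Rudin range. The value 1
    elsewhere keeps \<open>h\<close> positive on the whole space, where the Schur test is applied to
    the kernel \<open>k\<close> cut off to the ball.\<close>
  define h where "h z = (if z \<in> ball2 then (1 - (norm z)\<^sup>2) powr - (1 / (p * q)) else 1)" for z :: "complex \<times> complex"
  define k where "k z w = indicator ball2 z * indicator ball2 w * cmod (K_Gp p z w)" for z w
  have [measurable]: "(indicator ball2 :: _ \<Rightarrow> real) \<in> borel_measurable borel"
    by (rule borel_measurable_indicator[OF sets_ball2])
  have [measurable]: "Measurable.pred borel (\<lambda>z. z \<in> ball2)"
    using sets_ball2 by simp
  have h_meas [measurable]: "h \<in> borel_measurable borel"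
    unfolding h_def by measurable
  have k_meas: "case_prod k \<in> borel_measurable (borel \<Otimes>\<^sub>M borel)"
    using borel_measurable_K_Gp[of p] unfolding k_def split_beta' by measurable
  have h: "0 < h z" for z
    by (auto simp: h_def ball2_eq(1))
  have k: "0 \<le> k z w" for z w
    by (simp add: k_def)
  have hpow: "h z powr q = (1 - (norm z)\<^sup>2) powr - (1 / p)" "h z powr p = (1 - (norm z)\<^sup>2) powr - (1 / q)"
    if "z \<in> ball2" for z
    using that pq by (auto simp: h_def powr_powr)
  have invp: "0 < 1 / p" "1 / p < 1" and invq: "0 < 1 / q" "1 / q < 1"
    using pq by auto
  obtain C where C: "0 < C" and estC: "\<And>z. z \<in> ball2 \<Longrightarrow>
      (\<integral>\<^sup>+w. ennreal (cmod (K_Gp p z w) * (1 - (norm w)\<^sup>2) powr - (1 / p)) * indicator ball2 w \<partial>lborel)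
        \<le> ennreal (C * (1 - (norm z)\<^sup>2) powr - (1 / p))"
    by (rule K_Gp_weighted_estimate[OF invp pq(1)], rule that)
  obtain D where D: "0 < D" and estD: "\<And>z. z \<in> ball2 \<Longrightarrow>
      (\<integral>\<^sup>+w. ennreal (cmod (K_Gp p w z) * (1 - (norm w)\<^sup>2) powr - (1 / q)) * indicator ball2 w \<partial>lborel)
        \<le> ennreal (D * (1 - (norm z)\<^sup>2) powr - (1 / q))"
    by (rule K_Gp_weighted_estimate[OF invq pq(1)], rule that)
  have hq: "(\<integral>\<^sup>+w. ennreal (k z w * h w powr q) \<partial>lborel) \<le> ennreal (C * h z powr q)" for z
  proof (cases "z \<in> ball2")
    case True
    have "(\<integral>\<^sup>+w. ennreal (k z w * h w powr q) \<partial>lborel)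
        = (\<integral>\<^sup>+w. ennreal (cmod (K_Gp p z w) * (1 - (norm w)\<^sup>2) powr - (1 / p)) * indicator ball2 w \<partial>lborel)"
      using True by (intro nn_integral_cong) (auto simp: k_def hpow indicator_def)
    then show ?thesis
      using estC[OF True] True by (simp add: hpow)
  qed (simp add: k_def)
  have hp: "(\<integral>\<^sup>+z. ennreal (k z w * h z powr p) \<partial>lborel) \<le> ennreal (D * h w powr p)" for w
  proof (cases "w \<in> ball2")
    case True
    have "(\<integral>\<^sup>+z. ennreal (k z w * h z powr p) \<partial>lborel)
        = (\<integral>\<^sup>+z. ennreal (cmod (K_Gp p z w) * (1 - (norm z)\<^sup>2) powr - (1 / q)) * indicator ball2 z \<partial>lborel)"
      using True by (intro nn_integral_cong) (auto simp: k_def hpow indicator_def)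
    then show ?thesis
      using estD[OF True] True by (simp add: hpow)
  qed (simp add: k_def)
  define E where "E = C powr (p / q) * D"
  have E: "0 < E"
    using C D by (simp add: E_def)
  have "(AE z in lebesgue. z \<in> ball2 \<longrightarrow>
          set_integrable lebesgue ball2 (\<lambda>w. cmod (K_Gp p z w) *\<^sub>R f w)) \<and>
       (\<integral>\<^sup>+ z\<in>ball2. ennreal (cmod (LINT w:ball2|lebesgue. cmod (K_Gp p z w) *\<^sub>R f w) powr p)
            \<partial>lebesgue)
         \<le> ennreal ((E powr (1 / p)) powr p) * (\<integral>\<^sup>+ w\<in>ball2. ennreal (cmod (f w) powr p) \<partial>lebesgue)"
    if f [measurable]: "f \<in> borel_measurable lebesgue"
      and fin: "(\<integral>\<^sup>+ w\<in>ball2. ennreal (cmod (f w) powr p) \<partial>lebesgue) < \<infinity>" for f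
  proof -
    have ind [measurable]: "(indicator ball2 :: _ \<Rightarrow> real) \<in> borel_measurable lebesgue"
      by (rule measurable_completion) simp
    have "(\<lambda>w. indicator ball2 w * cmod (f w)) \<in> borel_measurable lebesgue"
      by measurable
    \<comment> \<open>As \<open>f\<close> is only Lebesgue measurable, its modulus on the ball is
      replaced by an almost everywhere equal Borel function, so that the Schur test can run on
      \<open>lborel\<close>. The absolute value in \<open>g\<close> restores nonnegativity at every
      point.\<close>
    then obtain g' where g' [measurable]: "g' \<in> borel_measurable lborel"
      and "AE w in lborel. indicator ball2 w * cmod (f w) = g' w"
      using completion_ex_borel_measurable_real by blast
    define g where "g w = \<bar>g' w\<bar>" for w
    have g_meas [measurable]: "g \<in> borel_measurable lborel"
      unfolding g_def by measurable
    have g: "AE w in lborel. g w = indicator ball2 w * cmod (f w)"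
      using \<open>AE w in lborel. _ = g' w\<close> by eventually_elim (auto simp: g_def dest!: sym[of _ "g' _"])
    have gp: "(\<integral>\<^sup>+w. ennreal (g w powr p) \<partial>lborel) = (\<integral>\<^sup>+ w\<in>ball2. ennreal (cmod (f w) powr p) \<partial>lebesgue)"
      unfolding nn_integral_completion
    proof (rule nn_integral_cong_AE)
      show "AE w in lborel. ennreal (g w powr p) = ennreal (cmod (f w) powr p) * indicator ball2 w"
        using g by eventually_elim (auto simp: indicator_def)
    qed
    define X where "X z = (\<integral>\<^sup>+w. ennreal (k z w * g w) \<partial>lborel)" for z
    have X_fin: "AE z in lborel. X z < \<infinity>"
      and X_int: "(\<integral>\<^sup>+z. ennreal (enn2real (X z) powr p) \<partial>lborel) \<le> ennreal E * (\<integral>\<^sup>+w. ennreal (g w powr p) \<partial>lborel)"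
      unfolding X_def E_def
      using Schur_test[OF sigma_finite_lborel pq, of k h C D g] k_meas h k C D hq hp fin gp
      by (simp_all add: g_def less_imp_le)
    have K_meas: "K_Gp p z \<in> borel_measurable lebesgue" for z
      using borel_measurable_K_Gp[of p] by (intro measurable_completion) simp
    \<comment> \<open>Finiteness of \<open>X z\<close> is thus exactly the absolute integrability of
      the integrand, which reduces the signed operator to the positive one.\<close>
    have X_eq: "(\<integral>\<^sup>+w. ennreal (norm (indicator ball2 w *\<^sub>R cmod (K_Gp p z w) *\<^sub>R f w)) \<partial>lebesgue) = X z"
      if "z \<in> ball2" for z
      unfolding X_def nn_integral_completion
    proof (rule nn_integral_cong_AE)
      show "AE w in lborel. ennreal (norm (indicator ball2 w *\<^sub>R cmod (K_Gp p z w) *\<^sub>R f w)) = ennreal (k z w * g w)"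
        using g by eventually_elim (use that in \<open>auto simp: k_def indicator_def\<close>)
    qed
    have int: "set_integrable lebesgue ball2 (\<lambda>w. cmod (K_Gp p z w) *\<^sub>R f w)" if "z \<in> ball2" "X z < \<infinity>" for z
    proof -
      note [measurable] = K_meas
      have "(\<lambda>w. indicator ball2 w *\<^sub>R cmod (K_Gp p z w) *\<^sub>R f w) \<in> borel_measurable lebesgue"
        by measurable
      then show ?thesis
        unfolding set_integrable_def integrable_iff_bounded X_eq[OF that(1)] using that by simp
    qed
    have "AE z in lebesgue. X z < \<infinity>"
      using X_fin by (rule AE_completion)
    then have ae: "AE z in lebesgue. z \<in> ball2 \<longrightarrow> set_integrable lebesgue ball2 (\<lambda>w. cmod (K_Gp p z w) *\<^sub>R f w)"
      by eventually_elim (use int in blast)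
    \<comment> \<open>Finiteness of \<open>X z\<close> gives integrability and ensures that
      \<open>enn2real\<close> keeps its value; the exceptional points form a null set.\<close>
    have le: "cmod (LINT w:ball2|lebesgue. cmod (K_Gp p z w) *\<^sub>R f w) \<le> enn2real (X z)"
      if z: "z \<in> ball2" and fin: "X z < \<infinity>" for z
    proof -
      have "ennreal (cmod (LINT w:ball2|lebesgue. cmod (K_Gp p z w) *\<^sub>R f w)) \<le> X z"
        using integral_norm_bound_ennreal[OF int[OF that, unfolded set_integrable_def]] X_eq[OF z]
        by (simp add: set_lebesgue_integral_def)
      then show ?thesis
        using enn2real_mono fin by fastforce
    qed
    have "(\<integral>\<^sup>+ z\<in>ball2. ennreal (cmod (LINT w:ball2|lebesgue. cmod (K_Gp p z w) *\<^sub>R f w) powr p) \<partial>lebesgue)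
        \<le> (\<integral>\<^sup>+z. ennreal (enn2real (X z) powr p) \<partial>lborel)"
      unfolding nn_integral_completion
    proof (rule nn_integral_mono_AE)
      show "AE z in lborel. ennreal (cmod (LINT w:ball2|lebesgue. cmod (K_Gp p z w) *\<^sub>R f w) powr p) * indicator ball2 z
          \<le> ennreal (enn2real (X z) powr p)"
        using X_fin
      proof eventually_elim
        case (elim z)
        then show ?case
          using le[of z] pq by (auto simp: indicator_def intro!: ennreal_leI powr_mono2)
      qed
    qed
    also have "\<dots> \<le> ennreal E * (\<integral>\<^sup>+ w\<in>ball2. ennreal (cmod (f w) powr p) \<partial>lebesgue)"
      using X_int unfolding gp .
    also have "E = (E powr (1 / p)) powr p"
      using E pq by (simp add: powr_powr)
    finally show ?thesis
      using ae by blast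
  qed
  then show ?thesis
    by (intro exI[of _ "E powr (1 / p)"]) simp
qed

end
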